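(* Let $H$ be a separable infinite-dimensional Hilbert space, and let $(f_n)_{n=1}^\infty$ and $(g_n)_{n=1}^\infty$ be frames in $H$ dual to each other. Let $U$ and $V$ denote the analysis operators of $(f_n)_{n=1}^\infty$ and $(g_n)_{n=1}^\infty$, respectively. Then (a) $l^2=\operatorname{Im}U\dot{+}\operatorname{Ker}V^*$; (b) $UV^*$ is the oblique projection onto $\operatorname{Im}U$ parallel to $\operatorname{Ker}V^*$; (c) $l^2=\operatorname{Im}V\dot{+}\operatorname{Ker}U^*$; (d) $VU^*$ is the oblique projection onto $\operatorname{Im}V$ parallel to $\operatorname{Ker}U^*$.
   Context: A sequence $(f_n)_{n=1}^\infty$ in $H$ is a frame if there exist constants $A,B>0$ with $A\|x\|^2\le\sum_{n=1}^\infty|\langle x,f_n\rangle|^2\le B\|x\|^2$ for all $x\in H$. Its analysis operator is the bounded operator $U:H\to l^2$, $Ux=(\langle x,f_n\rangle)_{n=1}^\infty$; the adjoint $U^*:l^2\to H$ is the synthesis operator, $U^*((c_n)_{n=1}^\infty)=\sum_{n=1}^\infty c_nf_n$. A frame $(g_n)_{n=1}^\infty$ in $H$ is a dual frame of $(f_n)_{n=1}^\infty$ (the two frames are dual to each other) if $x=\sum_{n=1}^{\infty}\langle x,f_n\rangle g_n=\sum_{n=1}^{\infty}\langle x,g_n\rangle f_n$ for all $x\in H$. For subspaces $X,Y$ with trivial intersection, $X\dot{+}Y$ denotes their (not necessarily orthogonal) direct sum. An oblique projection is a projection (idempotent) that need not be orthogonal; the projection onto $X$ parallel to $Y$ has range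 $X$ and kernel $Y$. $\operatorname{Im}$ and $\operatorname{Ker}$ denote range and kernel. *)

theory Defs
  imports "HOL-Analysis.Analysis" "HOL-Library.Function_Algebras"
begin

text \<open>
  Hilbert spaces are treated over \<open>\<real>\<close> and \<open>\<complex>\<close> simultaneously. By Gelfand-Mazur, every
  \<^class>\<open>real_normed_field\<close> is isometrically isomorphic to \<open>\<real>\<close> or \<open>\<complex>\<close>, and the equation
  \<open>x * conj x = \<bar>x\<bar>\<^sup>2\<close> then forces \<open>conj\<close> to be the identity, respectively complex
  conjugation. So the two instances below are, up to isomorphism, the only ones.
\<close>

class real_or_complex = real_normed_field + banach +
  fixes conj :: "'a \<Rightarrow> 'a"
  assumes conj_add: "conj (x + y) = conj x + conj y"
    and conj_mult: "conj (x * y) = conj x * conj y"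
    and conj_conj: "conj (conj x) = x"
    and mult_conj: "x * conj x = (norm x)\<^sup>2 *\<^sub>R 1"

instantiation real :: real_or_complex
begin
definition conj_real :: "real \<Rightarrow> real" where "conj_real x = x"
instance by standard (simp_all add: conj_real_def power2_eq_square)
end

instantiation complex :: real_or_complex
begin
definition conj_complex :: "complex \<Rightarrow> complex" where "conj_complex = cnj"
instance by standard (simp_all add: conj_complex_def complex_norm_square [symmetric] scaleR_conv_of_real)
end

text \<open>
  The inner product is linear in the first argument. The type class \<^class>\<open>banach\<close> supplies
  completeness, and the locale assumptions tie the norm (hence the topology) and the real
  scalar multiplication of the type to the inner product and to \<open>smul\<close>.
\<close>

locale hilbert_space = vector_space smul
  for smul :: "'k::real_or_complex \<Rightarrow> 'h::banach \<Rightarrow> 'h" +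
  fixes ip :: "'h \<Rightarrow> 'h \<Rightarrow> 'k"
  assumes smul_of_real: "smul (of_real r) x = r *\<^sub>R x"
    and ip_add_left: "ip (x + y) z = ip x z + ip y z"
    and ip_smul_left: "ip (smul a x) y = a * ip x y"
    and ip_commute: "ip y x = conj (ip x y)"
    and ip_self: "ip x x = of_real ((norm x)\<^sup>2)"

definition infinite_dimensional :: "('k::field \<Rightarrow> 'h::ab_group_add \<Rightarrow> 'h) \<Rightarrow> bool" where
  "infinite_dimensional smul \<longleftrightarrow> \<not> (\<exists>B. finite B \<and> module.span smul B = UNIV)"


definition l2 :: "(nat \<Rightarrow> 'k::real_or_complex) set" where
  "l2 = {c. summable (\<lambda>n. (norm (c n))\<^sup>2)}"

definition l2_scale :: "'k::real_or_complex \<Rightarrow> (nat \<Rightarrow> 'k) \<Rightarrow> (nat \<Rightarrow> 'k)" where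
  "l2_scale a c = (\<lambda>n. a * c n)"

definition l2_ip :: "(nat \<Rightarrow> 'k::real_or_complex) \<Rightarrow> (nat \<Rightarrow> 'k) \<Rightarrow> 'k" where
  "l2_ip c d = (\<Sum>n. c n * conj (d n))"

definition l2_norm :: "(nat \<Rightarrow> 'k::real_or_complex) \<Rightarrow> real" where
  "l2_norm c = sqrt (\<Sum>n. (norm (c n))\<^sup>2)"

lemma vector_space_l2_scale: "vector_space (l2_scale :: 'k::real_or_complex \<Rightarrow> _)"
  by standard (simp_all add: l2_scale_def fun_eq_iff algebra_simps)


text \<open>Sequences are indexed from 0.\<close>

definition frame :: "('h::banach \<Rightarrow> 'h \<Rightarrow> 'k::real_or_complex) \<Rightarrow> (nat \<Rightarrow> 'h) \<Rightarrow> bool" where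
  "frame ip f \<longleftrightarrow> (\<exists>A>0. \<exists>B>0. \<forall>x.
     summable (\<lambda>n. (norm (ip x (f n)))\<^sup>2) \<and>
     A * (norm x)\<^sup>2 \<le> (\<Sum>n. (norm (ip x (f n)))\<^sup>2) \<and>
     (\<Sum>n. (norm (ip x (f n)))\<^sup>2) \<le> B * (norm x)\<^sup>2)"

definition dual_frames ::
  "('k::real_or_complex \<Rightarrow> 'h::banach \<Rightarrow> 'h) \<Rightarrow> ('h \<Rightarrow> 'h \<Rightarrow> 'k) \<Rightarrow>
   (nat \<Rightarrow> 'h) \<Rightarrow> (nat \<Rightarrow> 'h) \<Rightarrow> bool" where
  "dual_frames smul ip f g \<longleftrightarrow> frame ip f \<and> frame ip g \<and>
     (\<forall>x. (\<lambda>n. smul (ip x (f n)) (g n)) sums x \<and> (\<lambda>n. smul (ip x (g n)) (f n)) sums x)"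

definition analysis ::
  "('h \<Rightarrow> 'h \<Rightarrow> 'k::real_or_complex) \<Rightarrow> (nat \<Rightarrow> 'h) \<Rightarrow> 'h \<Rightarrow> (nat \<Rightarrow> 'k)" where
  "analysis ip f x = (\<lambda>n. ip x (f n))"

text \<open>
  The Hilbert space adjoint of \<open>T : H \<rightarrow> l\<^sup>2\<close>. Only its values on \<^const>\<open>l2\<close> are
  meaningful; \<open>Ker T\<^sup>*\<close> is therefore taken inside \<^const>\<open>l2\<close>.
\<close>

definition l2_adjoint ::
  "('h \<Rightarrow> 'h \<Rightarrow> 'k::real_or_complex) \<Rightarrow> ('h \<Rightarrow> (nat \<Rightarrow> 'k)) \<Rightarrow> (nat \<Rightarrow> 'k) \<Rightarrow> 'h" where
  "l2_adjoint ip T c = (THE y. \<forall>x. l2_ip (T x) c = ip x y)"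

definition l2_Ker :: "((nat \<Rightarrow> 'k::real_or_complex) \<Rightarrow> 'b::zero) \<Rightarrow> (nat \<Rightarrow> 'k) set" where
  "l2_Ker S = {c \<in> l2. S c = 0}"


text \<open>\<open>l\<^sup>2\<close> is the (not necessarily orthogonal) direct sum of its subspaces \<open>X\<close> and \<open>Y\<close>;
  \<open>X + Y\<close> is the elementwise sum of sets.\<close>

definition l2_direct_sum ::
  "(nat \<Rightarrow> 'k::real_or_complex) set \<Rightarrow> (nat \<Rightarrow> 'k) set \<Rightarrow> bool" where
  "l2_direct_sum X Y \<longleftrightarrow>
     module.subspace l2_scale X \<and> module.subspace l2_scale Y \<and> X \<inter> Y = {0} \<and> l2 = X + Y"

text \<open>\<open>P\<close> restricts to a bounded linear idempotent operator on \<open>l\<^sup>2\<close> with range \<open>X\<close> and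
  kernel \<open>Y\<close>.\<close>

definition l2_oblique_projection ::
  "((nat \<Rightarrow> 'k::real_or_complex) \<Rightarrow> (nat \<Rightarrow> 'k)) \<Rightarrow> (nat \<Rightarrow> 'k) set \<Rightarrow> (nat \<Rightarrow> 'k) set \<Rightarrow> bool"
  where
  "l2_oblique_projection P X Y \<longleftrightarrow>
     P ` l2 \<subseteq> l2 \<and>
     (\<forall>c\<in>l2. \<forall>d\<in>l2. P (c + d) = P c + P d) \<and>
     (\<forall>a. \<forall>c\<in>l2. P (l2_scale a c) = l2_scale a (P c)) \<and>
     (\<exists>K. \<forall>c\<in>l2. l2_norm (P c) \<le> K * l2_norm c) \<and>
     (\<forall>c\<in>l2. P (P c) = P c) \<and>
     P ` l2 = X \<and> l2_Ker P = Y"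

end

theory Submission
  imports Defs
begin

text \<open>
  The upper frame inequality bounds the partial sums of \<open>\<Sum>n. c n f n\<close> by the norm of \<open>c\<close>
  (lemma \<open>bessel_bound_finite_sum\<close>), so the series converges for every square-summable \<open>c\<close>.
  Continuity of the inner product identifies its sum with \<open>U\<^sup>* c\<close> (lemma
  \<open>l2_adjoint_analysis\<close>), which makes the adjoint explicit: it exists, is linear and bounded.

  The reconstruction formula \<open>x = \<Sum>n. \<langle>x, f n\<rangle> g n\<close> now reads \<open>V\<^sup>* U = id\<close>: the operator \<open>U\<close> has
  the left inverse \<open>V\<^sup>*\<close>. The rest is algebra (lemma \<open>left_inverse_oblique_projection\<close>):
  \<open>U V\<^sup>*\<close> is idempotent, it has the range of \<open>U\<close> because \<open>V\<^sup>*\<close> is onto, and it has the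
  kernel of \<open>V\<^sup>*\<close> because \<open>U\<close> is injective; the splitting
  \<open>c = U V\<^sup>* c + (c - U V\<^sup>* c)\<close> gives the direct sum. Duality is symmetric in \<open>f\<close> and \<open>g\<close>,
  so exchanging them yields the statements about \<open>V U\<^sup>*\<close>.
\<close>

section \<open>Conjugation\<close>

lemma conj_zero [simp]: "conj (0::'k::real_or_complex) = 0"
  using conj_add[of "0::'k" 0] by simp

text \<open>The product \<open>x * conj x\<close> determines the norm of \<open>x\<close>, and it is unchanged when \<open>x\<close> is
  replaced by \<open>conj x\<close>, because \<open>conj\<close> is an involution.\<close>

lemma norm_conj [simp]: "norm (conj x) = norm (x::'k::real_or_complex)"
proof -
  have "(norm (conj x))\<^sup>2 *\<^sub>R (1::'k) = (norm x)\<^sup>2 *\<^sub>R 1"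
    using mult_conj[of x] mult_conj[of "conj x"] by (simp add: conj_conj mult.commute)
  then have "(norm (conj x))\<^sup>2 = (norm x)\<^sup>2" by simp
  then show ?thesis by simp
qed

lemma conj_of_real [simp]: "conj (of_real r) = (of_real r :: 'k::real_or_complex)"
proof (cases "r = 0")
  case False
  have "of_real r * conj (of_real r) = (of_real r * of_real r :: 'k)"
    using mult_conj[of "of_real r :: 'k"] by (simp add: power2_eq_square scaleR_conv_of_real)
  then show ?thesis using False by simp
qed simp

section \<open>Square-summable sequences\<close>

lemma l2_zero: "0 \<in> l2"
  by (simp add: l2_def)

lemma l2_add:
  assumes "c \<in> l2" "d \<in> l2" shows "c + d \<in> l2"
proof -
  have "summable (\<lambda>n. 2 * (norm (c n))\<^sup>2 + 2 * (norm (d n))\<^sup>2)"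
    using assms by (auto simp: l2_def intro!: summable_add summable_mult)
  moreover have "norm ((norm ((c + d) n))\<^sup>2) \<le> 2 * (norm (c n))\<^sup>2 + 2 * (norm (d n))\<^sup>2" for n
  proof -
    have "(norm (c n + d n))\<^sup>2 \<le> (norm (c n) + norm (d n))\<^sup>2"
      by (intro power_mono norm_triangle_ineq) simp
    also have "\<dots> \<le> 2 * (norm (c n))\<^sup>2 + 2 * (norm (d n))\<^sup>2"
      using sum_squares_bound[of "norm (c n)" "norm (d n)"] by (simp add: power2_sum)
    finally show ?thesis by simp
  qed
  ultimately show ?thesis
    unfolding l2_def by (auto intro: summable_comparison_test')
qed

lemma l2_closed_scale:
  assumes "c \<in> l2" shows "l2_scale a c \<in> l2"
  using assms by (simp add: l2_def l2_scale_def norm_mult power_mult_distrib summable_mult)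

lemma l2_diff:
  assumes "c \<in> l2" "d \<in> l2" shows "c - d \<in> l2"
proof -
  have "c - d = c + l2_scale (-1) d" by (simp add: l2_scale_def fun_eq_iff)
  then show ?thesis using l2_add[OF assms(1) l2_closed_scale[OF assms(2)]] by metis
qed

lemma L2_set_le_l2_norm:
  assumes "c \<in> l2" "finite I" shows "L2_set (\<lambda>n. norm (c n)) I \<le> l2_norm c"
  using assms unfolding L2_set_def l2_norm_def l2_def
  by (auto intro!: real_sqrt_le_mono sum_le_suminf)

section \<open>Projections from a left inverse\<close>

text \<open>
  Here \<open>T\<close> and \<open>S\<close> play the roles of an analysis operator and of the adjoint of the analysis
  operator of a dual frame. For a sequence \<open>T x\<close> in the kernel of \<open>S\<close>, the left inverse gives
  \<open>x = S (T x) = 0\<close>, so that the sum is direct.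
\<close>

lemma left_inverse_oblique_projection:
  fixes smul :: "'k::real_or_complex \<Rightarrow> 'h::real_normed_vector \<Rightarrow> 'h"
    and T :: "'h \<Rightarrow> nat \<Rightarrow> 'k" and S :: "(nat \<Rightarrow> 'k) \<Rightarrow> 'h"
  assumes smul: "vector_space smul"
    and T_l2: "\<And>x. T x \<in> l2"
    and T_add: "\<And>x y. T (x + y) = T x + T y"
    and T_scale: "\<And>a x. T (smul a x) = l2_scale a (T x)"
    and T_bounded: "0 \<le> L" "\<And>x. l2_norm (T x) \<le> L * norm x"
    and S_add: "\<And>c d. c \<in> l2 \<Longrightarrow> d \<in> l2 \<Longrightarrow> S (c + d) = S c + S d"
    and S_scale: "\<And>a c. c \<in> l2 \<Longrightarrow> S (l2_scale a c) = smul a (S c)"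
    and S_bounded: "\<And>c. c \<in> l2 \<Longrightarrow> norm (S c) \<le> M * l2_norm c"
    and left_inverse: "\<And>x. S (T x) = x"
  shows "l2_direct_sum (range T) (l2_Ker S) \<and>
         l2_oblique_projection (T \<circ> S) (range T) (l2_Ker S)"
proof -
  interpret H: vector_space smul by (rule smul)
  interpret l2: vector_space "l2_scale :: 'k \<Rightarrow> _" by (rule vector_space_l2_scale)
  have T_0: "T 0 = 0" using T_add[of 0 0] by simp
  have S_0: "S 0 = 0" using left_inverse[of 0] T_0 by simp
  have T_eq_0: "T x = 0 \<longleftrightarrow> x = 0" for x
    using left_inverse[of x] T_0 S_0 by auto
  have "l2.subspace (range T)"
    unfolding l2.subspace_def
    using rangeI[of T 0] by (auto simp: T_0 T_add[symmetric] T_scale[symmetric])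
  moreover have "l2.subspace (l2_Ker S)"
    unfolding l2.subspace_def l2_Ker_def
    by (auto simp: l2_zero S_0 l2_add l2_closed_scale S_add S_scale)
  moreover have "range T \<inter> l2_Ker S = {0}"
    using rangeI[of T 0] by (auto simp: l2_Ker_def left_inverse T_0 l2_zero S_0)
  moreover have "l2 = range T + l2_Ker S"
  proof
    show "l2 \<subseteq> range T + l2_Ker S"
    proof
      fix c :: "nat \<Rightarrow> 'k" assume c: "c \<in> l2"
      have d: "c - T (S c) \<in> l2" by (intro l2_diff c T_l2)
      have "S c = S (T (S c) + (c - T (S c)))" by simp
      also have "\<dots> = S c + S (c - T (S c))" by (subst S_add) (auto simp: T_l2 d left_inverse)
      finally have "c - T (S c) \<in> l2_Ker S" using d by (simp add: l2_Ker_def)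
      then have "T (S c) + (c - T (S c)) \<in> range T + l2_Ker S" by (intro set_plus_intro) auto
      then show "c \<in> range T + l2_Ker S" by simp
    qed
    show "range T + l2_Ker S \<subseteq> l2"
      by (auto simp: set_plus_def l2_Ker_def intro!: l2_add T_l2)
  qed
  moreover have "(T \<circ> S) ` l2 = range T"
  proof
    show "range T \<subseteq> (T \<circ> S) ` l2"
    proof
      fix c assume "c \<in> range T"
      then obtain x where "c = (T \<circ> S) (T x)" by (auto simp: left_inverse)
      then show "c \<in> (T \<circ> S) ` l2" using T_l2 by (rule image_eqI)
    qed
  qed auto
  moreover have "l2_Ker (T \<circ> S) = l2_Ker S"
    by (simp add: l2_Ker_def T_eq_0)
  moreover have "\<exists>K. \<forall>c\<in>l2. l2_norm ((T \<circ> S) c) \<le> K * l2_norm c"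
  proof (intro exI ballI)
    fix c :: "nat \<Rightarrow> 'k" assume c: "c \<in> l2"
    have "l2_norm (T (S c)) \<le> L * norm (S c)" by (rule T_bounded)
    also have "\<dots> \<le> L * (M * l2_norm c)" by (intro mult_left_mono S_bounded c T_bounded)
    finally show "l2_norm ((T \<circ> S) c) \<le> L * M * l2_norm c" by (simp add: mult.assoc)
  qed
  ultimately show ?thesis
    unfolding l2_direct_sum_def l2_oblique_projection_def
    by (auto simp: T_l2 S_add T_add S_scale T_scale left_inverse)
qed

section \<open>Inner products\<close>

context hilbert_space
begin

lemma ip_add_right: "ip x (y + z) = ip x y + ip x z"
  by (metis ip_commute ip_add_left conj_add)

lemma ip_smul_right: "ip x (smul a y) = conj a * ip x y"
  by (metis ip_commute ip_smul_left conj_mult)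

lemma ip_diff_right: "ip x (y - z) = ip x y - ip x z"
  using ip_add_right[of x "y - z" z] by simp

lemma ip_diff_left: "ip (x - y) z = ip x z - ip y z"
  using ip_add_left[of "x - y" y z] by simp

lemma ip_zero_left [simp]: "ip 0 z = 0"
  using ip_diff_left[of 0 0 z] by simp

lemma ip_zero_right [simp]: "ip z 0 = 0"
  using ip_diff_right[of z 0 0] by simp

lemma ip_sum_left: "ip (sum F I) z = (\<Sum>n\<in>I. ip (F n) z)"
  by (induction I rule: infinite_finite_induct) (simp_all add: ip_add_left)

lemma norm_ip_commute: "norm (ip x y) = norm (ip y x)"
  by (metis ip_commute norm_conj)

lemma ip_eqI:
  assumes "\<And>x. ip x y = ip x z" shows "y = z"
proof -
  have "ip (y - z) (y - z) = 0" by (simp add: ip_diff_right assms)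
  then show ?thesis by (simp add: ip_self)
qed

lemma norm_smul: "norm (smul a x) = norm a * norm x"
proof -
  have "of_real ((norm (smul a x))\<^sup>2) = a * conj a * ip x x"
    by (simp only: ip_self[symmetric] ip_smul_left ip_smul_right mult_ac)
  also have "\<dots> = of_real ((norm a * norm x)\<^sup>2)"
    by (simp add: mult_conj ip_self power_mult_distrib scaleR_conv_of_real)
  finally have "(norm (smul a x))\<^sup>2 = (norm a * norm x)\<^sup>2"
    by (simp only: of_real_eq_iff)
  then show ?thesis by simp
qed

lemma Cauchy_Schwarz: "norm (ip x y) \<le> norm x * norm y"
proof (cases "y = 0")
  case False
  define t where "t = (norm y)\<^sup>2"
  define s where "s = ip x y"
  have t: "t > 0" using False by (simp add: t_def)
  \<comment> \<open>Up to the factor \<open>t\<close>, this vector is the component of \<open>x\<close> orthogonal to \<open>y\<close>.\<close>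
  define z where "z = smul (of_real t) x - smul s y"
  have yx: "ip y x = conj s" unfolding s_def by (rule ip_commute)
  have ss: "s * conj s = of_real ((norm s)\<^sup>2)"
    by (simp add: mult_conj scaleR_conv_of_real)
  have "ip z z = of_real t * (of_real t * ip x x) - of_real t * (s * conj s)
      - of_real t * (s * conj s) + (s * conj s) * of_real t"
    unfolding z_def
    by (simp add: ip_diff_left ip_diff_right ip_smul_left ip_smul_right yx ip_self[of y]
        s_def[symmetric] t_def[symmetric] algebra_simps)
  also have "\<dots> = of_real (t * (t * (norm x)\<^sup>2 - (norm s)\<^sup>2))"
    by (simp add: ss ip_self algebra_simps)
  finally have "(norm z)\<^sup>2 = t * (t * (norm x)\<^sup>2 - (norm s)\<^sup>2)"
    by (simp only: ip_self of_real_eq_iff)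
  then have "0 \<le> t * (t * (norm x)\<^sup>2 - (norm s)\<^sup>2)" by (metis zero_le_power2)
  then have "(norm s)\<^sup>2 \<le> (norm x * norm y)\<^sup>2"
    using t by (simp add: zero_le_mult_iff t_def power_mult_distrib mult.commute)
  then show ?thesis unfolding s_def by (rule power2_le_imp_le) simp
qed simp

lemma bounded_linear_ip_right: "bounded_linear (ip x)"
proof (rule bounded_linear_intro[where K = "norm x"])
  show "ip x (r *\<^sub>R y) = r *\<^sub>R ip x y" for r y
    using ip_smul_right[of x "of_real r" y] by (simp add: smul_of_real scaleR_conv_of_real)
  show "norm (ip x y) \<le> norm y * norm x" for y
    using Cauchy_Schwarz[of x y] by (simp add: mult.commute)
qed (rule ip_add_right)

section \<open>Analysis and synthesis\<close>

text \<open>The number \<open>B\<close> bounds the operator norm of the analysis operator; it is the square root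
  of the constant in the usual, squared form of the Bessel inequality.\<close>

definition bessel_bound :: "(nat \<Rightarrow> 'h) \<Rightarrow> real \<Rightarrow> bool" where
  "bessel_bound f B \<longleftrightarrow> 0 \<le> B \<and> (\<forall>x. analysis ip f x \<in> l2 \<and> l2_norm (analysis ip f x) \<le> B * norm x)"

lemma frame_bessel_bound:
  assumes "frame ip f" obtains B where "bessel_bound f B"
proof -
  obtain B where B: "B > 0" and *: "\<And>x. summable (\<lambda>n. (norm (ip x (f n)))\<^sup>2)"
      "\<And>x. (\<Sum>n. (norm (ip x (f n)))\<^sup>2) \<le> B * (norm x)\<^sup>2"
    using assms unfolding frame_def by blast
  have "l2_norm (analysis ip f x) \<le> sqrt B * norm x" for x
    using real_sqrt_le_mono[OF *(2)[of x]] by (simp add: l2_norm_def analysis_def real_sqrt_mult)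
  then show ?thesis
    using B *(1) by (intro that[of "sqrt B"]) (simp add: bessel_bound_def l2_def analysis_def)
qed

text \<open>
  Writing \<open>S\<close> for the finite sum, \<open>\<bar>S\<bar>\<^sup>2 = \<Sum> c n \<langle>f n, S\<rangle>\<close> is at most the norm of \<open>c\<close> times that of
  the coefficients of \<open>S\<close>, and the Bessel inequality bounds the latter by \<open>B \<bar>S\<bar>\<close>; it remains to
  cancel one factor \<open>\<bar>S\<bar>\<close>.
\<close>

lemma bessel_bound_finite_sum:
  assumes B: "bessel_bound f B" and I: "finite I"
  shows "norm (\<Sum>n\<in>I. smul (c n) (f n)) \<le> B * L2_set (\<lambda>n. norm (c n)) I"
proof -
  define S where "S = (\<Sum>n\<in>I. smul (c n) (f n))"
  have "(norm S)\<^sup>2 = norm (ip S S)" by (simp add: ip_self norm_power)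
  also have "ip S S = (\<Sum>n\<in>I. c n * ip (f n) S)"
    by (subst (1) S_def) (simp add: ip_sum_left ip_smul_left)
  also have "norm \<dots> \<le> (\<Sum>n\<in>I. \<bar>norm (c n)\<bar> * \<bar>norm (ip S (f n))\<bar>)"
    by (rule order_trans[OF norm_sum]) (simp add: norm_mult norm_ip_commute)
  also have "\<dots> \<le> L2_set (\<lambda>n. norm (c n)) I * L2_set (\<lambda>n. norm (ip S (f n))) I"
    by (rule L2_set_mult_ineq)
  also have "\<dots> \<le> L2_set (\<lambda>n. norm (c n)) I * (B * norm S)"
    using B L2_set_le_l2_norm[of "analysis ip f S" I] I
    by (intro mult_left_mono L2_set_nonneg)
       (auto simp: bessel_bound_def analysis_def intro: order_trans)
  finally have "norm S * norm S \<le> (B * L2_set (\<lambda>n. norm (c n)) I) * norm S"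
    by (simp add: power2_eq_square mult_ac)
  moreover have "0 \<le> B * L2_set (\<lambda>n. norm (c n)) I"
    using B by (simp add: bessel_bound_def L2_set_nonneg)
  ultimately show ?thesis
    unfolding S_def[symmetric] by (cases "S = 0") auto
qed

lemma summable_synthesis:
  assumes B: "bessel_bound f B" and c: "c \<in> l2"
  shows "summable (\<lambda>n. smul (c n) (f n))"
  unfolding summable_Cauchy
proof (intro allI impI)
  fix e :: real assume e: "0 < e"
  have B0: "0 \<le> B" using B by (simp add: bessel_bound_def)
  define d where "d = e / (B + 1)"
  have d: "d > 0" using e B0 by (simp add: d_def)
  obtain N where N: "\<And>m n. m \<ge> N \<Longrightarrow> norm (\<Sum>k=m..<n. (norm (c k))\<^sup>2) < d\<^sup>2"
    using c zero_less_power[OF d, of 2] unfolding l2_def summable_Cauchy mem_Collect_eq by blast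
  have "norm (\<Sum>k=m..<n. smul (c k) (f k)) < e" if "m \<ge> N" for m n
  proof -
    have "L2_set (\<lambda>n. norm (c n)) {m..<n} \<le> d"
      using N[OF that, of n] d unfolding L2_set_def by (intro real_le_lsqrt) auto
    then have "norm (\<Sum>k=m..<n. smul (c k) (f k)) \<le> B * d"
      using bessel_bound_finite_sum[OF B, of "{m..<n}" c] B0
      by (meson finite_atLeastLessThan mult_left_mono order_trans)
    also have "\<dots> < e" using e B0 by (simp add: d_def field_simps)
    finally show ?thesis .
  qed
  then show "\<exists>N. \<forall>m\<ge>N. \<forall>n. norm (\<Sum>k=m..<n. smul (c k) (f k)) < e" by blast
qed

lemma norm_synthesis_le:
  assumes B: "bessel_bound f B" and c: "c \<in> l2"
  shows "norm (\<Sum>n. smul (c n) (f n)) \<le> B * l2_norm c"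
proof (rule LIMSEQ_le_const2)
  show "(\<lambda>N. norm (\<Sum>n<N. smul (c n) (f n))) \<longlonglongrightarrow> norm (\<Sum>n. smul (c n) (f n))"
    by (intro tendsto_norm summable_LIMSEQ summable_synthesis[OF assms])
  have "norm (\<Sum>n<N. smul (c n) (f n)) \<le> B * l2_norm c" for N
    using bessel_bound_finite_sum[OF B, of "{..<N}" c] L2_set_le_l2_norm[OF c, of "{..<N}"] B
    by (meson bessel_bound_def finite_lessThan mult_left_mono order_trans)
  then show "\<exists>N0. \<forall>N\<ge>N0. norm (\<Sum>n<N. smul (c n) (f n)) \<le> B * l2_norm c" by blast
qed

text \<open>
  Continuity of the inner product lets it pass through the series, so the sum has the property
  that defines the adjoint; nondegeneracy makes it the only such vector.
\<close>

lemma l2_ip_analysis: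
  assumes B: "bessel_bound f B" and c: "c \<in> l2"
  shows "l2_ip (analysis ip f x) c = ip x (\<Sum>n. smul (c n) (f n))"
  by (simp add: bounded_linear.suminf[OF bounded_linear_ip_right summable_synthesis[OF assms]]
      l2_ip_def analysis_def ip_smul_right mult.commute)

lemma l2_adjoint_analysis:
  assumes B: "bessel_bound f B" and c: "c \<in> l2"
  shows "l2_adjoint ip (analysis ip f) c = (\<Sum>n. smul (c n) (f n))"
  unfolding l2_adjoint_def
  by (rule the_equality) (auto simp: l2_ip_analysis[OF assms] intro: ip_eqI)

lemma synthesis_add:
  assumes "bessel_bound f B" "c \<in> l2" "d \<in> l2"
  shows "(\<Sum>n. smul ((c + d) n) (f n)) = (\<Sum>n. smul (c n) (f n)) + (\<Sum>n. smul (d n) (f n))"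
  by (simp add: scale_left_distrib suminf_add summable_synthesis[OF assms(1)] assms(2,3))

lemma bounded_linear_smul: "bounded_linear (smul a)"
proof (rule bounded_linear_intro[where K = "norm a"])
  show "smul a (r *\<^sub>R x) = r *\<^sub>R smul a x" for r x
    by (simp add: smul_of_real[symmetric] mult.commute)
qed (simp_all add: scale_right_distrib norm_smul mult.commute)

lemma synthesis_scale:
  assumes "bessel_bound f B" "c \<in> l2"
  shows "(\<Sum>n. smul (l2_scale a c n) (f n)) = smul a (\<Sum>n. smul (c n) (f n))"
  by (simp add: bounded_linear.suminf[OF bounded_linear_smul summable_synthesis[OF assms]]
      l2_scale_def)

text \<open>Half of the theorem; duality being symmetric, the other half is the same with \<open>f\<close> and \<open>g\<close>
  exchanged.\<close>

lemma dual_frames_oblique_projection: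
  assumes f: "frame ip f" and g: "frame ip g"
    and reconstruction: "\<And>x. (\<lambda>n. smul (ip x (f n)) (g n)) sums x"
  defines "T \<equiv> analysis ip f" and "S \<equiv> l2_adjoint ip (analysis ip g)"
  shows "l2_direct_sum (range T) (l2_Ker S) \<and>
         l2_oblique_projection (T \<circ> S) (range T) (l2_Ker S)"
proof -
  obtain L where L: "bessel_bound f L" using f by (rule frame_bessel_bound)
  obtain M where M: "bessel_bound g M" using g by (rule frame_bessel_bound)
  have T: "T x \<in> l2" "l2_norm (T x) \<le> L * norm x" "0 \<le> L" for x
    using L by (auto simp: bessel_bound_def T_def)
  have S: "S c = (\<Sum>n. smul (c n) (g n))" if "c \<in> l2" for c
    unfolding S_def by (rule l2_adjoint_analysis[OF M that])
  show ?thesis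
  proof (rule left_inverse_oblique_projection[where smul = smul and L = L and M = M])
    show "vector_space smul" by (rule vector_space_axioms)
    show "S (T x) = x" for x
      using sums_unique[OF reconstruction[of x]] by (simp add: S T) (simp add: T_def analysis_def)
  qed (simp_all add: T S l2_add l2_closed_scale synthesis_add[OF M] synthesis_scale[OF M]
        norm_synthesis_le[OF M] del: plus_fun_apply,
       simp_all add: T_def analysis_def ip_add_left ip_smul_left l2_scale_def fun_eq_iff)
qed

end

theorem corollary2p3:
  fixes smul :: "'k::real_or_complex \<Rightarrow> 'h::banach \<Rightarrow> 'h"
    and ip :: "'h \<Rightarrow> 'h \<Rightarrow> 'k"
    and f g :: "nat \<Rightarrow> 'h"
    and U V :: "'h \<Rightarrow> (nat \<Rightarrow> 'k)"
    and U_adj V_adj :: "(nat \<Rightarrow> 'k) \<Rightarrow> 'h"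
  assumes "hilbert_space smul ip"
    and "separable_space (euclidean :: 'h topology)"
    and "infinite_dimensional smul"
    and "frame ip f" and "frame ip g"
    and "dual_frames smul ip f g"
  defines "U \<equiv> analysis ip f" and "V \<equiv> analysis ip g"
  defines "U_adj \<equiv> l2_adjoint ip U" and "V_adj \<equiv> l2_adjoint ip V"
  shows "l2_direct_sum (range U) (l2_Ker V_adj) \<and>
         l2_oblique_projection (U \<circ> V_adj) (range U) (l2_Ker V_adj) \<and>
         l2_direct_sum (range V) (l2_Ker U_adj) \<and>
         l2_oblique_projection (V \<circ> U_adj) (range V) (l2_Ker U_adj)"
proof -
  interpret hilbert_space smul ip by (rule assms(1))
  have "(\<lambda>n. smul (ip x (f n)) (g n)) sums x" "(\<lambda>n. smul (ip x (g n)) (f n)) sums x" for x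
    using assms(6) by (simp_all add: dual_frames_def)
  then show ?thesis
    using dual_frames_oblique_projection[of f g] dual_frames_oblique_projection[of g f] assms(4,5)
    unfolding U_adj_def V_adj_def U_def V_def by blast
qed

end
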